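(* Let $f\colon \mathbb{S}^{n\times n}\to\mathbb{R}$ be twice continuously differentiable. If $Y\in\mathrm{St}(d,n)^m$ (so that $Y$ is square, $p=n$) is a second-order critical point of $(\mathrm{RP}_n)$, then $X=YY^\top$ is a KKT point of $(\mathrm{P})$. If $Y\in\mathrm{St}(d,n)^m$ has full rank $n$, it suffices that $Y$ be a (first-order) critical point of $(\mathrm{RP}_n)$ for $X=YY^\top$ to be a KKT point of $(\mathrm{P})$.
   Context: Integers satisfy $m\ge 1$, $1\le d\le p\le n=md$ (here $p=n$). $\mathbb{S}^{k\times k}$ is the space of real symmetric $k\times k$ matrices. Matrices $M\in\mathbb{R}^{n\times n}$ are viewed as $m\times m$ block matrices with blocks $M_{ij}\in\mathbb{R}^{d\times d}$; $Y\in\mathbb{R}^{n\times p}$ is viewed as a stack of slices $Y_1,\dots,Y_m\in\mathbb{R}^{d\times p}$. Inner product: $\langle A,B\rangle=\operatorname{trace}(A^\top B)$. $\nabla f(X)\in\mathbb{S}^{n\times n}$ and $\nabla^2 f(X)$ are the Euclidean gradient and Hessian operator of $f$ on $\mathbb{S}^{n\times n}$. Define $\mathrm{St}(d,p)^m=\{Y\in\mathbb{R}^{n\times p}: Y_iY_i^\top=I_d,\ i=1,\dots,m\}$ and $\mathcal{C}=\{X\in\mathbb{S}^{n\times n}: X\succeq 0,\ X_{ii}=I_d,\ i=1,\dots,m\}$. Problem $(\mathrm{P})$: minimize $f(X)$ over $X\in\mathcal{C}$. Problem $(\mathrm{RP}_p)$: minimize $g(Y)=f(YY^\top)$ over $Y\in\mathrm{St}(d,p)^m$.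 $\operatorname{symblockdiag}(M)$ is the matrix with diagonal blocks $(M_{ii}+M_{ii}^\top)/2$ and all other blocks zero. The tangent space is $\mathrm{T}_Y\mathrm{St}(d,p)^m=\{\dot Y\in\mathbb{R}^{n\times p}:\operatorname{symblockdiag}(\dot YY^\top+Y\dot Y^\top)=0\}$. With $X=YY^\top$, $Y\in\mathrm{St}(d,p)^m$ is a critical point of $(\mathrm{RP}_p)$ if the Riemannian gradient of $g$ vanishes, i.e. $(\nabla f(X)-\operatorname{symblockdiag}(\nabla f(X)X))Y=0$. It is a second-order critical point if moreover the Riemannian Hessian is positive semidefinite, i.e. $\langle\dot Y,\nabla^2 g(Y)[\dot Y]-\operatorname{symblockdiag}(\nabla g(Y)Y^\top)\dot Y\rangle\ge 0$ for all $\dot Y\in\mathrm{T}_Y\mathrm{St}(d,p)^m$, where $\nabla g(Y)=2\nabla f(X)Y$ and $\nabla^2g(Y)[\dot Y]=2(\nabla^2f(X)[\dot X]Y+\nabla f(X)\dot Y)$ with $\dot X=\dot YY^\top+Y\dot Y^\top$. $X\in\mathcal{C}$ is a KKT point of $(\mathrm{P})$ if there exist $\hat S\in\mathbb{S}^{n\times n}$ and a symmetric block-diagonal (with $d\times d$ blocks) $\hat\Lambda\in\mathbb{S}^{n\times n}$ such that $\hat SX=0$, $\hat S=\nabla f(X)+\hat\Lambda$ and $\hat S\succeq 0$. *)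

theory Defs
  imports "HOL-Analysis.Analysis"
begin

text \<open>
  Rows and columns of an \<open>n \<times> n\<close> matrix with \<open>n = m d\<close> are indexed by pairs in
  \<open>'m \<times> 'd\<close>: the first component selects one of the \<open>m\<close> blocks, the second the position
  inside it.  Thus \<open>m = CARD('m) \<ge> 1\<close>, \<open>d = CARD('d) \<ge> 1\<close> and \<open>n = CARD('m) * CARD('d)\<close>.
  The inner product \<open>\<bullet>\<close> of matrices is the trace inner product (\<open>inner_eq_trace\<close> below).
\<close>

definition block ::
    "real^('m::finite \<times> 'd::finite)^('m \<times> 'd) \<Rightarrow> 'm \<Rightarrow> 'm \<Rightarrow> real^'d^'d"
  where "block M i j = (\<chi> a b. M $ (i, a) $ (j, b))"

definition row_slice :: "real^'p^('m::finite \<times> 'd::finite) \<Rightarrow> 'm \<Rightarrow> real^'p^'d"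
  where "row_slice Y i = (\<chi> a. Y $ (i, a))"

definition sym_mats :: "(real^'n^'n) set"
  where "sym_mats = {A. transpose A = A}"

definition psd :: "real^'n^'n \<Rightarrow> bool"
  where "psd A \<longleftrightarrow> A \<in> sym_mats \<and> (\<forall>x. x \<bullet> (A *v x) \<ge> 0)"

definition stiefel_product :: "(real^'p^('m::finite \<times> 'd::finite)) set"
  where "stiefel_product = {Y. \<forall>i. row_slice Y i ** transpose (row_slice Y i) = mat 1}"

definition feasible :: "(real^('m::finite \<times> 'd::finite)^('m \<times> 'd)) set"
  where "feasible = {X. psd X \<and> (\<forall>i. block X i i = mat 1)}"

definition symblockdiag ::
    "real^('m::finite \<times> 'd::finite)^('m \<times> 'd) \<Rightarrow> real^('m \<times> 'd)^('m \<times> 'd)"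
  where "symblockdiag M =
    (\<chi> r c. if fst r = fst c
            then ((1/2) *\<^sub>R (block M (fst r) (fst r) + transpose (block M (fst r) (fst r))))
                   $ snd r $ snd c
            else 0)"

definition block_diagonal :: "real^('m::finite \<times> 'd::finite)^('m \<times> 'd) \<Rightarrow> bool"
  where "block_diagonal M \<longleftrightarrow> (\<forall>i j. i \<noteq> j \<longrightarrow> block M i j = 0)"

text \<open>
  A function on the space of symmetric matrices is represented by a function on all square
  matrices whose values outside \<^const>\<open>sym_mats\<close> are irrelevant: every derivative is taken
  within \<^const>\<open>sym_mats\<close>.  Such a derivative is determined on symmetric directions only, so
  \<open>sym_hessian f X\<close> is to be applied to symmetric matrices only.
\<close>

definition sym_gradient :: "(real^'n^'n \<Rightarrow> real) \<Rightarrow> real^'n^'n \<Rightarrow> real^'n^'n"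
  where "sym_gradient f X =
    (THE G. G \<in> sym_mats \<and> (f has_derivative (\<lambda>H. G \<bullet> H)) (at X within sym_mats))"

definition sym_hessian :: "(real^'n^'n \<Rightarrow> real) \<Rightarrow> real^'n^'n \<Rightarrow> real^'n^'n \<Rightarrow> real^'n^'n"
  where "sym_hessian f X = frechet_derivative (sym_gradient f) (at X within sym_mats)"

definition C2_on_sym :: "(real^'n^'n \<Rightarrow> real) \<Rightarrow> bool"
  where "C2_on_sym f \<longleftrightarrow>
    f differentiable_on sym_mats \<and>
    (\<exists>D :: real^'n^'n \<Rightarrow> ((real^'n^'n) \<Rightarrow>\<^sub>L (real^'n^'n)).
       (\<forall>X\<in>sym_mats. (sym_gradient f has_derivative blinfun_apply (D X)) (at X within sym_mats)) \<and>
       continuous_on sym_mats D)"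

text \<open>
  Explicit formulas for the Euclidean gradient and Hessian of \<open>g Y = f (Y ** transpose Y)\<close>; see
  \<open>lifted_gradient_correct\<close> and \<open>lifted_hessian_correct\<close> below.
\<close>

definition lifted_gradient :: "(real^'n^'n \<Rightarrow> real) \<Rightarrow> real^'p^'n \<Rightarrow> real^'p^'n"
  where "lifted_gradient f Y = 2 *\<^sub>R (sym_gradient f (Y ** transpose Y) ** Y)"

definition lifted_hessian ::
    "(real^'n^'n \<Rightarrow> real) \<Rightarrow> real^'p^'n \<Rightarrow> real^'p^'n \<Rightarrow> real^'p^'n"
  where "lifted_hessian f Y V =
    2 *\<^sub>R (sym_hessian f (Y ** transpose Y) (V ** transpose Y + Y ** transpose V) ** Y
           + sym_gradient f (Y ** transpose Y) ** V)"

definition tangent_space ::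
    "real^'p^('m::finite \<times> 'd::finite) \<Rightarrow> (real^'p^('m \<times> 'd)) set"
  where "tangent_space Y = {V. symblockdiag (V ** transpose Y + Y ** transpose V) = 0}"

definition critical_point ::
    "(real^('m::finite \<times> 'd::finite)^('m \<times> 'd) \<Rightarrow> real) \<Rightarrow> real^'p^('m \<times> 'd) \<Rightarrow> bool"
  where "critical_point f Y \<longleftrightarrow>
    Y \<in> stiefel_product \<and>
    (let X = Y ** transpose Y
     in (sym_gradient f X - symblockdiag (sym_gradient f X ** X)) ** Y = 0)"

definition second_order_critical_point ::
    "(real^('m::finite \<times> 'd::finite)^('m \<times> 'd) \<Rightarrow> real) \<Rightarrow> real^'p^('m \<times> 'd) \<Rightarrow> bool"
  where "second_order_critical_point f Y \<longleftrightarrow>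
    critical_point f Y \<and>
    (\<forall>V\<in>tangent_space Y.
       V \<bullet> (lifted_hessian f Y V - symblockdiag (lifted_gradient f Y ** transpose Y) ** V) \<ge> 0)"

definition kkt_point ::
    "(real^('m::finite \<times> 'd::finite)^('m \<times> 'd) \<Rightarrow> real) \<Rightarrow> real^('m \<times> 'd)^('m \<times> 'd) \<Rightarrow> bool"
  where "kkt_point f X \<longleftrightarrow>
    X \<in> feasible \<and>
    (\<exists>S \<Lambda>. S \<in> sym_mats \<and> \<Lambda> \<in> sym_mats \<and> block_diagonal \<Lambda> \<and>
       S ** X = 0 \<and> S = sym_gradient f X + \<Lambda> \<and> psd S)"

lemma inner_eq_trace: "A \<bullet> B = trace (transpose A ** B)" for A B :: "real^'p^'n"
  unfolding trace_def transpose_def matrix_matrix_mult_def inner_vec_def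
  by (simp, rule sum.swap)

lemma subspace_sym_mats: "subspace sym_mats"
  by (auto simp: subspace_def sym_mats_def transpose_def vec_eq_iff)

lemma sym_derivative_unique:
  fixes f :: "real^'n^'n \<Rightarrow> 'b::real_normed_vector"
  assumes D1: "(f has_derivative D1) (at X within sym_mats)"
    and D2: "(f has_derivative D2) (at X within sym_mats)"
    and X: "X \<in> sym_mats" and H: "H \<in> sym_mats"
  shows "D1 H = D2 H"
proof -
  have im: "(\<lambda>t. X + t *\<^sub>R H) ` UNIV \<subseteq> sym_mats"
    using X H subspace_sym_mats by (auto intro: subspace_add subspace_scale)
  have c: "((\<lambda>t::real. f (X + t *\<^sub>R H)) has_derivative (\<lambda>t. D (t *\<^sub>R H))) (at 0)"
    if D: "(f has_derivative D) (at X within sym_mats)" for D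
  proof -
    have "((\<lambda>t::real. X + t *\<^sub>R H) has_derivative (\<lambda>t. t *\<^sub>R H)) (at 0 within UNIV)"
      by (auto intro!: derivative_eq_intros)
    moreover have "(f has_derivative D) (at (X + 0 *\<^sub>R H) within range (\<lambda>t::real. X + t *\<^sub>R H))"
      using has_derivative_subset[OF D im] by simp
    ultimately show ?thesis
      using has_derivative_in_compose by fastforce
  qed
  have "(\<lambda>t::real. D1 (t *\<^sub>R H)) = (\<lambda>t. D2 (t *\<^sub>R H))"
    using has_derivative_unique[OF c[OF D1] c[OF D2]] .
  from fun_cong[OF this, of 1] show ?thesis by simp
qed

lemma sym_gradient_unique:
  assumes "G \<in> sym_mats" "(f has_derivative (\<lambda>H. G \<bullet> H)) (at X within sym_mats)"
    and "X \<in> sym_mats"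
  shows "sym_gradient f X = G"
  unfolding sym_gradient_def
proof (rule the_equality)
  fix G' assume G': "G' \<in> sym_mats \<and> (f has_derivative (\<lambda>H. G' \<bullet> H)) (at X within sym_mats)"
  then have "G' - G \<in> sym_mats"
    using assms subspace_sym_mats by (auto intro: subspace_diff)
  then have "G' \<bullet> (G' - G) = G \<bullet> (G' - G)"
    using sym_derivative_unique[of f "\<lambda>H. G' \<bullet> H" X "\<lambda>H. G \<bullet> H"] G' assms by auto
  then have "(G' - G) \<bullet> (G' - G) = 0"
    by (simp add: inner_diff_left)
  then show "G' = G" by simp
qed (use assms in auto)

lemma sym_gradient_correct:
  fixes f :: "real^'n^'n \<Rightarrow> real"
  assumes f: "f differentiable (at X within sym_mats)" and X: "X \<in> sym_mats"
  shows "sym_gradient f X \<in> sym_mats"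
    and "(f has_derivative (\<lambda>H. sym_gradient f X \<bullet> H)) (at X within sym_mats)"
proof -
  obtain D where D: "(f has_derivative D) (at X within sym_mats)"
    using f by (auto simp: differentiable_def)
  then have lin: "linear D" by (rule has_derivative_linear)
  define G0 where "G0 = adjoint D 1"
  have G0: "D H = G0 \<bullet> H" for H
    using adjoint_works[OF lin, of H 1] by (simp add: G0_def inner_commute)
  define G where "G = (1/2) *\<^sub>R (G0 + transpose G0)"
  have tr: "transpose A \<bullet> B = A \<bullet> transpose B" for A B :: "real^'a^'a"
    unfolding inner_vec_def transpose_def by (simp, rule sum.swap)
  have G: "G \<in> sym_mats"
    by (auto simp: G_def sym_mats_def transpose_def vec_eq_iff)
  have eq: "G \<bullet> H = D H" if "H \<in> sym_mats" for H
    using that tr[of G0 H] by (simp add: G_def G0 inner_add_left sym_mats_def)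
  have "(f has_derivative (\<lambda>H. G \<bullet> H)) (at X within sym_mats)"
    unfolding has_derivative_within
  proof
    show "((\<lambda>Z. (1 / norm (Z - X)) *\<^sub>R (f Z - (f X + G \<bullet> (Z - X)))) \<longlongrightarrow> 0)
           (at X within sym_mats)"
    proof (rule Lim_transform_within[where d = 1])
      show "((\<lambda>Z. (1 / norm (Z - X)) *\<^sub>R (f Z - (f X + D (Z - X)))) \<longlongrightarrow> 0)
             (at X within sym_mats)"
        using D by (simp add: has_derivative_within)
      fix Z :: "real^'n^'n" assume "Z \<in> sym_mats"
      then have "G \<bullet> (Z - X) = D (Z - X)"
        by (intro eq subspace_diff subspace_sym_mats X)
      then show "(1 / norm (Z - X)) *\<^sub>R (f Z - (f X + D (Z - X))) =
                 (1 / norm (Z - X)) *\<^sub>R (f Z - (f X + G \<bullet> (Z - X)))"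
        by simp
    qed simp
  qed (rule bounded_linear_inner_right)
  with sym_gradient_unique[OF G this X] G
  show "sym_gradient f X \<in> sym_mats"
    and "(f has_derivative (\<lambda>H. sym_gradient f X \<bullet> H)) (at X within sym_mats)"
    by auto
qed

lemma inner_transpose: "transpose A \<bullet> transpose B = A \<bullet> B" for A B :: "real^'p^'n"
  unfolding inner_vec_def transpose_def by (simp, rule sum.swap)

lemma inner_matrix_mult_right: "A \<bullet> (B ** transpose C) = (A ** C) \<bullet> B"
  for A :: "real^'n^'k" and B :: "real^'p^'k" and C :: "real^'p^'n"
proof -
  have "(\<Sum>j\<in>UNIV. \<Sum>l\<in>UNIV. A $ i $ j * (B $ i $ l * C $ j $ l)) =
        (\<Sum>l\<in>UNIV. \<Sum>j\<in>UNIV. A $ i $ j * (B $ i $ l * C $ j $ l))" for i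
    by (rule sum.swap)
  then show ?thesis
    unfolding inner_vec_def transpose_def matrix_matrix_mult_def
    by (simp add: sum_distrib_left sum_distrib_right mult_ac)
qed

lemma bounded_bilinear_matrix_mult:
  "bounded_bilinear ((**) :: real^'n^'k \<Rightarrow> real^'p^'n \<Rightarrow> real^'p^'k)"
  unfolding bilinear_conv_bounded_bilinear[symmetric] bilinear_def linear_iff
  by (auto simp: matrix_matrix_mult_def vec_eq_iff sum.distrib sum_distrib_left algebra_simps)

lemma bounded_linear_transpose: "bounded_linear (transpose :: real^'p^'n \<Rightarrow> real^'n^'p)"
  unfolding linear_conv_bounded_linear[symmetric] linear_iff
  by (auto simp: transpose_def vec_eq_iff)

lemma gram_in_sym_mats: "Y ** transpose Y \<in> sym_mats" for Y :: "real^'p^'n"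
  by (simp add: sym_mats_def matrix_transpose_mul)

lemma gram_has_derivative:
  "((\<lambda>Y :: real^'p^'n. Y ** transpose Y) has_derivative
    (\<lambda>V. V ** transpose Y + Y ** transpose V)) (at Y)"
  using bounded_bilinear.FDERIV[OF bounded_bilinear_matrix_mult has_derivative_ident
      bounded_linear_imp_has_derivative[OF bounded_linear_transpose], of Y UNIV]
  by (simp add: add.commute)

lemma gram_comp_has_derivative:
  assumes "(F has_derivative D) (at (Y ** transpose Y) within sym_mats)"
  shows "((\<lambda>Y :: real^'p^'n. F (Y ** transpose Y)) has_derivative
          (\<lambda>V. D (V ** transpose Y + Y ** transpose V))) (at Y)"
proof (rule has_derivative_in_compose[OF gram_has_derivative])
  show "(F has_derivative D) (at (Y ** transpose Y) within range (\<lambda>Y :: real^'p^'n. Y ** transpose Y))"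
    by (rule has_derivative_subset[OF assms]) (auto intro: gram_in_sym_mats)
qed

lemma lifted_gradient_correct:
  fixes Y :: "real^'p^'n"
  assumes "C2_on_sym f"
  shows "((\<lambda>Y. f (Y ** transpose Y)) has_derivative (\<lambda>V. lifted_gradient f Y \<bullet> V)) (at Y)"
proof -
  define X where "X = Y ** transpose Y"
  have X: "X \<in> sym_mats" by (simp add: X_def gram_in_sym_mats)
  then have f: "f differentiable (at X within sym_mats)"
    using assms by (simp add: C2_on_sym_def differentiable_on_def)
  note G = sym_gradient_correct(1)[OF f X] and D = sym_gradient_correct(2)[OF f X]
  have "sym_gradient f X \<bullet> (Y ** transpose V) = sym_gradient f X \<bullet> (V ** transpose Y)" for V
    using inner_transpose[of "sym_gradient f X" "Y ** transpose V"] G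
    by (simp only: sym_mats_def mem_Collect_eq matrix_transpose_mul transpose_transpose)
  then have "sym_gradient f X \<bullet> (V ** transpose Y + Y ** transpose V) = lifted_gradient f Y \<bullet> V"
    for V
    by (simp add: inner_add_right inner_matrix_mult_right lifted_gradient_def flip: X_def)
  then show ?thesis
    using gram_comp_has_derivative[OF D[unfolded X_def]] by (simp add: X_def)
qed

lemma lifted_hessian_correct:
  fixes Y :: "real^'p^'n"
  assumes "C2_on_sym f"
  shows "(lifted_gradient f has_derivative lifted_hessian f Y) (at Y)"
proof -
  define X where "X = Y ** transpose Y"
  have "X \<in> sym_mats" by (simp add: X_def gram_in_sym_mats)
  then have "sym_gradient f differentiable (at X within sym_mats)"
    using assms unfolding C2_on_sym_def differentiable_def by blast
  then have "(sym_gradient f has_derivative sym_hessian f X) (at X within sym_mats)"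
    unfolding sym_hessian_def by (rule frechet_derivative_works[THEN iffD1])
  from gram_comp_has_derivative[OF this[unfolded X_def]]
  have "((\<lambda>Y :: real^'p^'n. sym_gradient f (Y ** transpose Y) ** Y) has_derivative
     (\<lambda>V. sym_gradient f X ** V + sym_hessian f X (V ** transpose Y + Y ** transpose V) ** Y)) (at Y)"
    unfolding X_def
    by (rule bounded_bilinear.FDERIV[OF bounded_bilinear_matrix_mult _ has_derivative_ident])
  from has_derivative_scaleR_right[OF this, of 2] show ?thesis
    unfolding lifted_gradient_def[abs_def] lifted_hessian_def[abs_def] X_def
    by (simp only: add.commute)
qed

end

theory Submission
  imports Defs
begin

text \<open>
  The multiplier \<open>S = \<nabla>f(X) - symblockdiag(\<nabla>f(X) X)\<close> satisfies \<open>S Y = 0\<close> by criticality, so only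
  \<open>S \<succeq> 0\<close> is at stake.  If \<open>Y\<close> has full rank then \<open>S = 0\<close>.  Otherwise, \<open>Y\<close> being square, there is
  \<open>z \<noteq> 0\<close> with \<open>Y z = 0\<close>; the direction \<open>V = x z\<^sup>T\<close> satisfies \<open>V Y\<^sup>T = 0\<close>, hence it is tangent and
  leaves \<open>X\<close> unchanged to first order, so that the second-order condition along \<open>V\<close> reads
  \<open>2 \<parallel>z\<parallel>\<^sup>2 \<langle>x, S x\<rangle> \<ge> 0\<close>.
\<close>

definition outer_product :: "real^'n \<Rightarrow> real^'p \<Rightarrow> real^'p^'n"
  where "outer_product x z = (\<chi> i j. x $ i * z $ j)"

lemma matrix_mult_outer_product: "A ** outer_product x z = outer_product (A *v x) z"
  by (simp add: outer_product_def matrix_matrix_mult_def matrix_vector_mult_def vec_eq_iff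
      sum_distrib_right mult.assoc)

text \<open>Turns a kernel vector \<open>z\<close> of \<open>Y\<close> into directions
  \<open>V\<close> with \<open>V ** transpose Y = 0\<close>.\<close>

lemma outer_product_mult_transpose:
  "outer_product x z ** transpose Y = outer_product x (Y *v z)"
  by (simp add: outer_product_def matrix_matrix_mult_def matrix_vector_mult_def transpose_def
      vec_eq_iff sum_distrib_left mult_ac)

lemma outer_product_0_right [simp]: "outer_product x 0 = 0"
  by (simp add: outer_product_def vec_eq_iff)

lemma inner_outer_product:
  "outer_product x z \<bullet> outer_product y w = (x \<bullet> y) * (z \<bullet> w)"
proof -
  have "(\<Sum>j\<in>UNIV. x $ i * z $ j * (y $ i * w $ j)) = (x $ i * y $ i) * (z \<bullet> w)" for i
    by (simp add: inner_vec_def sum_distrib_left mult_ac)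
  then show ?thesis
    by (simp add: outer_product_def inner_vec_def flip: sum_distrib_right)
qed

lemma mult_transpose_eq_0_sym:
  fixes A :: "real^'p^'n" and B :: "real^'p^'k"
  assumes "A ** transpose B = 0"
  shows "B ** transpose A = 0"
proof -
  have "B ** transpose A = transpose (A ** transpose B)"
    by (simp add: matrix_transpose_mul)
  with assms show ?thesis
    by (simp add: transpose_def vec_eq_iff)
qed

lemma symblockdiag_in_sym_mats: "symblockdiag M \<in> sym_mats"
  by (auto simp: symblockdiag_def sym_mats_def transpose_def vec_eq_iff block_def)

lemma block_diagonal_symblockdiag: "block_diagonal (symblockdiag M)"
  by (auto simp: symblockdiag_def block_diagonal_def vec_eq_iff block_def)

lemma symblockdiag_scaleR: "symblockdiag (c *\<^sub>R M) = c *\<^sub>R symblockdiag M"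
  by (auto simp: symblockdiag_def transpose_def vec_eq_iff block_def algebra_simps)

lemma block_diagonal_uminus: "block_diagonal M \<Longrightarrow> block_diagonal (- M)"
  by (auto simp: block_diagonal_def vec_eq_iff block_def)

lemma symblockdiag_0 [simp]: "symblockdiag 0 = 0"
  by (simp add: symblockdiag_def transpose_def vec_eq_iff block_def)

text \<open>The quadratic form at \<open>x\<close> is the squared norm of
  \<open>transpose Y *v x\<close>, written \<open>x v* Y\<close>.\<close>

lemma psd_gram: "psd (Y ** transpose Y)" for Y :: "real^'p^'n"
proof -
  have "x \<bullet> ((Y ** transpose Y) *v x) = (x v* Y) \<bullet> (x v* Y)" for x
    by (simp add: dot_lmul_matrix flip: matrix_vector_mul_assoc)
  then show ?thesis
    by (simp add: psd_def gram_in_sym_mats)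
qed

lemma gram_feasible:
  assumes "Y \<in> stiefel_product"
  shows "Y ** transpose Y \<in> feasible"
proof -
  have "block (Y ** transpose Y) i i = row_slice Y i ** transpose (row_slice Y i)" for i
    by (simp add: block_def row_slice_def matrix_matrix_mult_def transpose_def)
  with assms psd_gram[of Y] show ?thesis
    by (simp add: feasible_def stiefel_product_def)
qed

text \<open>The only possible \<open>S\<close> at a feasible \<open>X\<close>: as the diagonal
  blocks of \<open>X\<close> are identities, those of \<open>S ** X = 0\<close> determine the
  block-diagonal \<open>\<Lambda>\<close>.\<close>

definition multiplier ::
    "(real^('m::finite \<times> 'd::finite)^('m \<times> 'd) \<Rightarrow> real) \<Rightarrow> real^('m \<times> 'd)^('m \<times> 'd)
      \<Rightarrow> real^('m \<times> 'd)^('m \<times> 'd)"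
  where "multiplier f X = sym_gradient f X - symblockdiag (sym_gradient f X ** X)"

lemma critical_point_iff_multiplier:
  "critical_point f Y \<longleftrightarrow>
    Y \<in> stiefel_product \<and> multiplier f (Y ** transpose Y) ** Y = 0"
  by (simp add: critical_point_def multiplier_def Let_def)

lemma multiplier_in_sym_mats:
  assumes "C2_on_sym f" "X \<in> sym_mats"
  shows "multiplier f X \<in> sym_mats"
proof -
  have "f differentiable (at X within sym_mats)"
    using assms by (simp add: C2_on_sym_def differentiable_on_def)
  then have "sym_gradient f X \<in> sym_mats"
    using assms(2) by (rule sym_gradient_correct)
  then show ?thesis
    unfolding multiplier_def
    by (intro subspace_diff[OF subspace_sym_mats] symblockdiag_in_sym_mats)
qed

text \<open>Criticality says that the multiplier annihilates \<open>Y\<close>, hence also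
  \<open>Y ** transpose Y\<close>; semidefiniteness is the one KKT condition left to assume.\<close>

lemma kkt_pointI:
  assumes "critical_point f Y" "psd (multiplier f (Y ** transpose Y))"
  shows "kkt_point f (Y ** transpose Y)"
  unfolding kkt_point_def
proof (intro conjI exI)
  let ?X = "Y ** transpose Y"
  let ?B = "symblockdiag (sym_gradient f ?X ** ?X)"
  show "?X \<in> feasible"
    using assms(1) by (simp add: gram_feasible critical_point_def)
  show "multiplier f ?X \<in> sym_mats" "psd (multiplier f ?X)"
    using assms(2) by (auto simp: psd_def)
  show "- ?B \<in> sym_mats"
    by (intro subspace_neg[OF subspace_sym_mats] symblockdiag_in_sym_mats)
  show "block_diagonal (- ?B)"
    by (intro block_diagonal_uminus block_diagonal_symblockdiag)
  show "multiplier f ?X = sym_gradient f ?X + - ?B"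
    by (simp add: multiplier_def)
  have "multiplier f ?X ** Y = 0"
    using assms(1) by (simp add: critical_point_iff_multiplier)
  then show "multiplier f ?X ** ?X = 0"
    by (simp add: matrix_mul_assoc)
qed

lemma psd_0: "psd (0 :: real^'n^'n)"
  by (simp add: psd_def sym_mats_def transpose_def vec_eq_iff)

text \<open>Full row rank makes \<open>Y\<close> surjective as a linear map, so \<open>S\<close>
  vanishes on every vector.\<close>

lemma matrix_mult_eq_0_full_rank:
  fixes S :: "real^'n^'k" and Y :: "real^'p^'n"
  assumes "S ** Y = 0" "rank Y = CARD('n)"
  shows "S = 0"
proof -
  have "surj ((*v) Y)"
    using assms(2) by (simp add: full_rank_surjective)
  have "S *v x = 0" for x
  proof -
    obtain z where "x = Y *v z"
      using \<open>surj ((*v) Y)\<close> by (metis surjD)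
    with assms(1) show ?thesis
      by (simp add: matrix_vector_mul_assoc)
  qed
  then show ?thesis
    by (simp add: matrix_eq)
qed

lemma kkt_point_full_rank:
  fixes Y :: "real^'p^('m::finite \<times> 'd::finite)"
  assumes "critical_point f Y" "rank Y = CARD('m) * CARD('d)"
  shows "kkt_point f (Y ** transpose Y)"
proof (rule kkt_pointI[OF assms(1)])
  have "multiplier f (Y ** transpose Y) = 0"
    using assms by (intro matrix_mult_eq_0_full_rank[of _ Y])
      (simp_all add: critical_point_iff_multiplier)
  then show "psd (multiplier f (Y ** transpose Y))"
    by (simp add: psd_0)
qed

text \<open>\<open>frechet_derivative\<close> is a choice operator; its value is known to be linear
  only because the gradient is differentiable at \<open>X\<close>.\<close>

lemma sym_hessian_0:
  assumes "C2_on_sym f" "X \<in> sym_mats"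
  shows "sym_hessian f X 0 = 0"
proof -
  have "sym_gradient f differentiable (at X within sym_mats)"
    using assms unfolding C2_on_sym_def differentiable_def by blast
  then show ?thesis
    unfolding sym_hessian_def
    by (intro linear_0 has_derivative_linear) (rule frechet_derivative_works[THEN iffD1])
qed

text \<open>Both \<open>V ** transpose Y\<close> and its transpose vanish, so the Hessian of
  \<open>f\<close> is evaluated at 0 and drops out. The terms in the gradient of \<open>f\<close>
  remain; the factor 2 comes from \<open>lifted_gradient\<close> and
  \<open>lifted_hessian\<close>.\<close>

lemma riemannian_hessian_vertical:
  assumes f: "C2_on_sym f" and V: "V ** transpose Y = 0"
  shows "lifted_hessian f Y V - symblockdiag (lifted_gradient f Y ** transpose Y) ** V =
    2 *\<^sub>R (multiplier f (Y ** transpose Y) ** V)"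
proof -
  let ?G = "sym_gradient f (Y ** transpose Y)"
  have "lifted_hessian f Y V = 2 *\<^sub>R (?G ** V)"
    by (simp add: lifted_hessian_def V mult_transpose_eq_0_sym[OF V] sym_hessian_0[OF f gram_in_sym_mats])
  moreover have "lifted_gradient f Y ** transpose Y = 2 *\<^sub>R (?G ** (Y ** transpose Y))"
    by (simp add: lifted_gradient_def matrix_mul_assoc
        bounded_bilinear.scaleR_left[OF bounded_bilinear_matrix_mult])
  ultimately show ?thesis
    by (simp add: multiplier_def symblockdiag_scaleR scaleR_diff_right
        bounded_bilinear.scaleR_left[OF bounded_bilinear_matrix_mult]
        bounded_bilinear.diff_left[OF bounded_bilinear_matrix_mult])
qed

lemma kkt_point_rank_deficient:
  fixes Y :: "real^'p^('m::finite \<times> 'd::finite)"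
  assumes f: "C2_on_sym f" and Y: "second_order_critical_point f Y"
    and rank: "rank Y \<noteq> CARD('p)"
  shows "kkt_point f (Y ** transpose Y)"
proof (rule kkt_pointI)
  let ?S = "multiplier f (Y ** transpose Y)"
  show "critical_point f Y"
    using Y by (simp add: second_order_critical_point_def)
  \<comment> \<open>Rank different from the number of columns means that \<open>Y\<close> is not
    injective.\<close>
  obtain z where z: "Y *v z = 0" "z \<noteq> 0"
    using rank by (auto simp: full_rank_injective matrix_left_invertible_injective[symmetric]
        matrix_left_invertible_ker)
  have "x \<bullet> (?S *v x) \<ge> 0" for x
  proof -
    define V where "V = outer_product x z"
    have V: "V ** transpose Y = 0"
      by (simp add: V_def outer_product_mult_transpose z)
    then have "V \<in> tangent_space Y"
      by (simp add: tangent_space_def mult_transpose_eq_0_sym)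
    then have "0 \<le> V \<bullet> (2 *\<^sub>R (?S ** V))"
      using Y unfolding riemannian_hessian_vertical[OF f V, symmetric]
        second_order_critical_point_def by blast
    \<comment> \<open>\<open>?S ** V\<close> is again an outer product, of \<open>?S *v x\<close>
      and \<open>z\<close>, so the trace inner product factorizes.\<close>
    also have "\<dots> = 2 * ((x \<bullet> (?S *v x)) * (z \<bullet> z))"
      by (simp add: V_def matrix_mult_outer_product inner_outer_product)
    \<comment> \<open>The factor \<open>z \<bullet> z\<close> is positive and can be
      cancelled.\<close>
    finally show ?thesis
      using z(2) by (simp add: zero_le_mult_iff inner_gt_zero_iff[symmetric] less_le_not_le
          del: inner_gt_zero_iff)
  qed
  then show "psd ?S"
    by (simp add: psd_def multiplier_in_sym_mats[OF f gram_in_sym_mats])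
qed

theorem theorem3p8:
  fixes f :: "real^('m::finite \<times> 'd::finite)^('m \<times> 'd) \<Rightarrow> real"
    and Y :: "real^'p::finite^('m \<times> 'd)"
  assumes "C2_on_sym f"
    and "CARD('p) = CARD('m) * CARD('d)"
    and "Y \<in> stiefel_product"
  shows "(second_order_critical_point f Y \<longrightarrow> kkt_point f (Y ** transpose Y)) \<and>
         (rank Y = CARD('m) * CARD('d) \<and> critical_point f Y \<longrightarrow> kkt_point f (Y ** transpose Y))"
proof (intro conjI impI)
  assume Y: "second_order_critical_point f Y"
  show "kkt_point f (Y ** transpose Y)"
  \<comment> \<open>Squareness enters here: it identifies full column rank, whose failure provides a
    kernel vector, with full row rank, which forces the multiplier to be zero.\<close>
  proof (cases "rank Y = CARD('p)")
    case True
    with Y assms(2) show ?thesis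
      by (intro kkt_point_full_rank) (simp_all add: second_order_critical_point_def)
  next
    case False
    with assms(1) Y show ?thesis
      by (rule kkt_point_rank_deficient)
  qed
qed (simp add: kkt_point_full_rank)

end
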